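(* In CCSK with its proved labelled transition system, for all (reachable) processes $X,X_1,Y$ and enhanced keyed labels $\theta_1,\theta_2$ with $X\xrightarrow{\theta_1}X_1\xrightarrow{\theta_2}Y$ and $\theta_1\smile\theta_2$ (in this trace), there exists $X_2$ such that $X\xrightarrow{\theta_2}X_2\xrightarrow{\theta_1}Y$.
   Context: **Syntax of CCSK.** Let $\mathsf N=\{a,b,c,\dots\}$ be a set of names, $\overline{\mathsf N}=\{\bar a,\bar b,\bar c,\dots\}$ the set of co-names, with a bijection $\overline{\,\cdot\,}:\mathsf N\to\overline{\mathsf N}$ whose inverse is also written $\overline{\,\cdot\,}$. Labels: $\mathsf L=\mathsf N\cup\overline{\mathsf N}\cup\{\tau\}$; $\alpha,\beta$ range over $\mathsf L$ and $\lambda$ over $\mathsf L\setminus\{\tau\}$. Let $\mathsf K=\{m,n,\dots\}$ be a set of keys, ranged over by $k$. Processes: $X,Y ::= 0 \mid \alpha.X \mid \alpha[k].X \mid X\backslash a \mid X+Y \mid (X\mid Y)$. $\mathrm{key}(X)$ is the set of keys occurring in $X$; $X$ is standard, $\mathrm{std}(X)$, iff $\mathrm{key}(X)=\emptyset$. **Enhanced keyed labels.** With $\upsilon,\upsilon_L,\upsilon_R$ strings in $\{|_L,|_R\}^*$: $\theta ::= \upsilon\alpha[k]$ or $\upsilon\langle |_L\upsilon_L\alpha[k],\ |_R\upsilon_R\bar\alpha[k]\rangle$. Put $\ell(\upsilon\alpha[k])=\alpha$, $\ell$ of the second form $=\tau$, and $\kappa(\theta)=k$ in both cases. **Proved LTS.**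 Forward transitions $X\xrightarrow{\theta}X'$ are inductively generated by: - (act.) $\alpha.X\xrightarrow{\alpha[k]}\alpha[k].X$ if $\mathrm{std}(X)$; - (pre.) $\alpha[k].X\xrightarrow{\theta}\alpha[k].X'$ if $X\xrightarrow{\theta}X'$ and $\kappa(\theta)\neq k$; - (res.) $X\backslash a\xrightarrow{\theta}X'\backslash a$ if $X\xrightarrow{\theta}X'$ and $\ell(\theta)\notin\{a,\bar a\}$; - ($|_L$) $X\mid Y\xrightarrow{|_L\theta}X'\mid Y$ if $X\xrightarrow{\theta}X'$ and $\kappa(\theta)\notin\mathrm{key}(Y)$; ($|_R$) symmetrically, $X\mid Y\xrightarrow{|_R\theta}X\mid Y'$ if $Y\xrightarrow{\theta}Y'$ and $\kappa(\theta)\notin\mathrm{key}(X)$; - (syn.) $X\mid Y\xrightarrow{\langle |_L\upsilon_L\lambda[k],\,|_R\upsilon_R\bar\lambda[k]\rangle}X'\mid Y'$ if $X\xrightarrow{\upsilon_L\lambda[k]}X'$ and $Y\xrightarrow{\upsilon_R\bar\lambda[k]}Y'$; - ($+_L$) $X+Y\xrightarrow{\theta}X'+Y$ if $X\xrightarrow{\theta}X'$ and $\mathrm{std}(Y)$; ($+_R$) symmetrically. Backward transitions $X'\overset{\theta}{\rightsquigarrow}X$ are generated by the exact symmetric rules (source and target exchanged in premises and conclusion, same labels and side conditions). Write $X\overset{\theta}{\twoheadrightarrow}Y$ if $X\xrightarrow{\theta}Y$ or $X\overset{\theta}{\rightsquigarrow}Y$. A process $X$ is reachable if there is a standard $O_X$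 from which $X$ is reached by a finite sequence of $\twoheadrightarrow$-steps. All processes considered are reachable. **Dependency and concurrency.** The dependency relation $\lessdot$ on enhanced keyed labels is induced by (is the least relation satisfying), for $d\in\{L,R\}$: $\alpha[k]\lessdot\theta$ for every $\theta$; $|_d\theta\lessdot|_d\theta'$ if $\theta\lessdot\theta'$; $\langle\theta_L,\theta_R\rangle\lessdot\theta$ if $\theta_d\lessdot\theta$ for some $d$; $\theta\lessdot\langle\theta_L,\theta_R\rangle$ if $\theta\lessdot\theta_d$ for some $d$; $\langle\theta_L,\theta_R\rangle\lessdot\langle\theta_L',\theta_R'\rangle$ if $\theta_d\lessdot\theta_d'$ for some $d$. (Here $\theta_L,\theta_R$ include their leading $|_L$, $|_R$.) In a trace $T:X_1\overset{\theta_1}{\twoheadrightarrow}\cdots\overset{\theta_n}{\twoheadrightarrow}X_{n+1}$, for $i<j$, $\theta_i\lessdot_T\theta_j$ iff $\theta_i\lessdot\theta_j$; and $\theta_i\smile_T\theta_j$ (written also $\theta_i\smile\theta_j$; "concurrent") iff neither $\theta_i\lessdot_T\theta_j$ nor $\theta_j\lessdot_T\theta_i$. Thus for $i<j$, $\theta_i\smile_T\theta_j$ iff not $\theta_i\lessdot\theta_j$. *)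

theory Defs imports Main begin

datatype 'n vis = Name 'n | Coname 'n

fun co :: "'n vis \<Rightarrow> 'n vis" where
  "co (Name a) = Coname a"
| "co (Coname a) = Name a"

datatype 'n label = Vis "'n vis" | Tau

datatype ('n, 'k) process =
    Zero
  | Prefix "'n label" "('n, 'k) process"
  | KPrefix "'n label" 'k "('n, 'k) process"
  | Restrict "('n, 'k) process" 'n
  | Choice "('n, 'k) process" "('n, 'k) process"
  | Par "('n, 'k) process" "('n, 'k) process"

primrec keys :: "('n, 'k) process \<Rightarrow> 'k set" where
  "keys Zero = {}"
| "keys (Prefix \<alpha> X) = keys X"
| "keys (KPrefix \<alpha> k X) = insert k (keys X)"
| "keys (Restrict X a) = keys X"
| "keys (Choice X Y) = keys X \<union> keys Y"
| "keys (Par X Y) = keys X \<union> keys Y"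

definition std :: "('n, 'k) process \<Rightarrow> bool" where
  "std X \<longleftrightarrow> keys X = {}"

datatype dir = DL | DR

text \<open>
  With a string over the two parallel tags represented as a list over \<^typ>\<open>dir\<close>,
  \<open>Single u \<alpha> k\<close> is the label \<open>u \<alpha>[k]\<close>, and \<open>Sync u uL l uR k\<close> is the label
  \<open>u \<langle>|\<^sub>L uL l[k], |\<^sub>R uR (co l)[k]\<rangle>\<close>. In the latter the leading tags of the two
  components are left implicit in \<open>uL\<close> and \<open>uR\<close>, and the action is visible, since \<open>Tau\<close>
  has no complement.
\<close>

datatype ('n, 'k) elabel =
    Single "dir list" "'n label" 'k
  | Sync "dir list" "dir list" "'n vis" "dir list" 'k

primrec lab :: "('n, 'k) elabel \<Rightarrow> 'n label" where
  "lab (Single u \<alpha> k) = \<alpha>"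
| "lab (Sync u uL l uR k) = Tau"

primrec key_of :: "('n, 'k) elabel \<Rightarrow> 'k" where
  "key_of (Single u \<alpha> k) = k"
| "key_of (Sync u uL l uR k) = k"

primrec tag :: "dir \<Rightarrow> ('n, 'k) elabel \<Rightarrow> ('n, 'k) elabel" where
  "tag d (Single u \<alpha> k) = Single (d # u) \<alpha> k"
| "tag d (Sync u uL l uR k) = Sync (d # u) uL l uR k"

inductive fwd :: "('n, 'k) process \<Rightarrow> ('n, 'k) elabel \<Rightarrow> ('n, 'k) process \<Rightarrow> bool"
    ("_ \<midarrow>_\<rightarrow> _" [51, 0, 51] 50) where
  act: "std X \<Longrightarrow> Prefix \<alpha> X \<midarrow>Single [] \<alpha> k\<rightarrow> KPrefix \<alpha> k X"
| pre: "X \<midarrow>\<theta>\<rightarrow> X' \<Longrightarrow> key_of \<theta> \<noteq> k \<Longrightarrow> KPrefix \<alpha> k X \<midarrow>\<theta>\<rightarrow> KPrefix \<alpha> k X'"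
| res: "X \<midarrow>\<theta>\<rightarrow> X' \<Longrightarrow> lab \<theta> \<notin> {Vis (Name a), Vis (Coname a)} \<Longrightarrow>
        Restrict X a \<midarrow>\<theta>\<rightarrow> Restrict X' a"
| parL: "X \<midarrow>\<theta>\<rightarrow> X' \<Longrightarrow> key_of \<theta> \<notin> keys Y \<Longrightarrow> Par X Y \<midarrow>tag DL \<theta>\<rightarrow> Par X' Y"
| parR: "Y \<midarrow>\<theta>\<rightarrow> Y' \<Longrightarrow> key_of \<theta> \<notin> keys X \<Longrightarrow> Par X Y \<midarrow>tag DR \<theta>\<rightarrow> Par X Y'"
| syn: "X \<midarrow>Single uL (Vis l) k\<rightarrow> X' \<Longrightarrow> Y \<midarrow>Single uR (Vis (co l)) k\<rightarrow> Y' \<Longrightarrow>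
        Par X Y \<midarrow>Sync [] uL l uR k\<rightarrow> Par X' Y'"
| sumL: "X \<midarrow>\<theta>\<rightarrow> X' \<Longrightarrow> std Y \<Longrightarrow> Choice X Y \<midarrow>\<theta>\<rightarrow> Choice X' Y"
| sumR: "Y \<midarrow>\<theta>\<rightarrow> Y' \<Longrightarrow> std X \<Longrightarrow> Choice X Y \<midarrow>\<theta>\<rightarrow> Choice X Y'"

inductive bwd :: "('n, 'k) process \<Rightarrow> ('n, 'k) elabel \<Rightarrow> ('n, 'k) process \<Rightarrow> bool"
    ("_ \<midarrow>_\<leadsto> _" [51, 0, 51] 50) where
  act: "std X \<Longrightarrow> KPrefix \<alpha> k X \<midarrow>Single [] \<alpha> k\<leadsto> Prefix \<alpha> X"
| pre: "X' \<midarrow>\<theta>\<leadsto> X \<Longrightarrow> key_of \<theta> \<noteq> k \<Longrightarrow> KPrefix \<alpha> k X' \<midarrow>\<theta>\<leadsto> KPrefix \<alpha> k X"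
| res: "X' \<midarrow>\<theta>\<leadsto> X \<Longrightarrow> lab \<theta> \<notin> {Vis (Name a), Vis (Coname a)} \<Longrightarrow>
        Restrict X' a \<midarrow>\<theta>\<leadsto> Restrict X a"
| parL: "X' \<midarrow>\<theta>\<leadsto> X \<Longrightarrow> key_of \<theta> \<notin> keys Y \<Longrightarrow> Par X' Y \<midarrow>tag DL \<theta>\<leadsto> Par X Y"
| parR: "Y' \<midarrow>\<theta>\<leadsto> Y \<Longrightarrow> key_of \<theta> \<notin> keys X \<Longrightarrow> Par X Y' \<midarrow>tag DR \<theta>\<leadsto> Par X Y"
| syn: "X' \<midarrow>Single uL (Vis l) k\<leadsto> X \<Longrightarrow> Y' \<midarrow>Single uR (Vis (co l)) k\<leadsto> Y \<Longrightarrow>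
        Par X' Y' \<midarrow>Sync [] uL l uR k\<leadsto> Par X Y"
| sumL: "X' \<midarrow>\<theta>\<leadsto> X \<Longrightarrow> std Y \<Longrightarrow> Choice X' Y \<midarrow>\<theta>\<leadsto> Choice X Y"
| sumR: "Y' \<midarrow>\<theta>\<leadsto> Y \<Longrightarrow> std X \<Longrightarrow> Choice X Y' \<midarrow>\<theta>\<leadsto> Choice X Y"

definition step :: "('n, 'k) process \<Rightarrow> ('n, 'k) process \<Rightarrow> bool" where
  "step X Y \<longleftrightarrow> (\<exists>\<theta>. X \<midarrow>\<theta>\<rightarrow> Y \<or> X \<midarrow>\<theta>\<leadsto> Y)"

definition reachable :: "('n, 'k) process \<Rightarrow> bool" where
  "reachable X \<longleftrightarrow> (\<exists>O\<^sub>X. std O\<^sub>X \<and> step\<^sup>*\<^sup>* O\<^sub>X X)"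

text \<open>
  \<open>side d uL l uR k\<close> is the \<open>d\<close>-component of \<open>Sync [] uL l uR k\<close>, including its leading tag.
\<close>

primrec side :: "dir \<Rightarrow> dir list \<Rightarrow> 'n vis \<Rightarrow> dir list \<Rightarrow> 'k \<Rightarrow> ('n, 'k) elabel" where
  "side DL uL l uR k = Single (DL # uL) (Vis l) k"
| "side DR uL l uR k = Single (DR # uR) (Vis (co l)) k"

inductive dep :: "('n, 'k) elabel \<Rightarrow> ('n, 'k) elabel \<Rightarrow> bool" (infix "\<lessdot>" 50) where
  dep_prefix: "Single [] \<alpha> k \<lessdot> \<theta>"
| dep_tag: "\<theta> \<lessdot> \<theta>' \<Longrightarrow> tag d \<theta> \<lessdot> tag d \<theta>'"
| dep_sync_left: "side d uL l uR k \<lessdot> \<theta> \<Longrightarrow> Sync [] uL l uR k \<lessdot> \<theta>"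
| dep_sync_right: "\<theta> \<lessdot> side d uL l uR k \<Longrightarrow> \<theta> \<lessdot> Sync [] uL l uR k"
| dep_sync_both: "side d uL l uR k \<lessdot> side d uL' l' uR' k' \<Longrightarrow>
    Sync [] uL l uR k \<lessdot> Sync [] uL' l' uR' k'"

text \<open>
  Dependency and concurrency in a trace relate occurrences of labels and depend on the trace only
  through its sequence of labels. So they are defined on that sequence, with an occurrence given
  by its position, counted from 0.
\<close>

definition dep_in :: "('n, 'k) elabel list \<Rightarrow> nat \<Rightarrow> nat \<Rightarrow> bool" where
  "dep_in T i j \<longleftrightarrow> i < j \<and> j < length T \<and> T ! i \<lessdot> T ! j"

definition concurrent_in :: "('n, 'k) elabel list \<Rightarrow> nat \<Rightarrow> nat \<Rightarrow> bool" where
  "concurrent_in T i j \<longleftrightarrow>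
     i < length T \<and> j < length T \<and> i \<noteq> j \<and> \<not> dep_in T i j \<and> \<not> dep_in T j i"

end

theory Submission imports Defs begin

text \<open>
  A forward step adds exactly its own key, which is fresh, so two consecutive steps have different
  keys and the side conditions on keys survive the exchange. With this, induction on the first step
  exchanges two steps whenever the first label does not precede the second in \<open>\<lessdot>\<close>: independence of
  two labels under a common tag, or of the components of synchronisations, is inherited by the
  premises of the two steps, and a first step by rule \<open>act\<close> is excluded because its label precedes
  every label.
\<close>

inductive_cases KPrefix_fwdE: "KPrefix \<alpha> k X \<midarrow>\<theta>\<rightarrow> Z"
inductive_cases Restrict_fwdE: "Restrict X a \<midarrow>\<theta>\<rightarrow> Z"
inductive_cases Choice_fwdE: "Choice X Y \<midarrow>\<theta>\<rightarrow> Z"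
inductive_cases Par_fwdE [consumes 1, case_names left right sync]: "Par X Y \<midarrow>\<theta>\<rightarrow> Z"

lemma fwd_keys: "X \<midarrow>\<theta>\<rightarrow> X' \<Longrightarrow> keys X' = insert (key_of \<theta>) (keys X)"
proof (induction rule: fwd.induct)
  case (parL X \<theta> X' Y)
  then show ?case by (cases \<theta>) auto
next
  case (parR Y \<theta> Y' X)
  then show ?case by (cases \<theta>) auto
qed auto

lemma key_of_tag [simp]: "key_of (tag d \<theta>) = key_of \<theta>"
  by (cases \<theta>) simp_all

text \<open>The side conditions enforce this: \<open>std\<close> in \<open>act\<close> and for the
  idle summand, the key inequality in \<open>pre\<close>, non-membership in the idle component in
  \<open>parL\<close> and \<open>parR\<close>. In \<open>syn\<close> both premises carry the same
  key.\<close>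

lemma fwd_key_fresh: "X \<midarrow>\<theta>\<rightarrow> X' \<Longrightarrow> key_of \<theta> \<notin> keys X"
  by (induction rule: fwd.induct) (auto simp: std_def)

lemma fwd_fwd_key_neq:
  assumes "X \<midarrow>\<theta>\<^sub>1\<rightarrow> X'" "X' \<midarrow>\<theta>\<^sub>2\<rightarrow> X''"
  shows "key_of \<theta>\<^sub>2 \<noteq> key_of \<theta>\<^sub>1"
  using fwd_keys[OF assms(1)] fwd_key_fresh[OF assms(2)] by auto

text \<open>Excludes a change of summand: once one summand has moved, it violates the
  \<open>std\<close> condition under which the other could move.\<close>

lemma fwd_not_std: "X \<midarrow>\<theta>\<rightarrow> X' \<Longrightarrow> \<not> std X'"
  by (simp add: std_def fwd_keys)

text \<open>Exposes the leading tag of each component, so that \<open>dep_tag\<close> can produce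
  dependencies between components of synchronisations.\<close>

lemma side_eq_tag:
  "side DL uL l uR k = tag DL (Single uL (Vis l) k)"
  "side DR uL l uR k = tag DR (Single uR (Vis (co l)) k)"
  by simp_all

text \<open>Used by contraposition, as are the next two lemmas: independence of the composite labels
  passes to the component labels, as the induction hypothesis requires.\<close>

lemma dep_tag_sync:
  "\<theta> \<lessdot> Single uL (Vis l) k \<Longrightarrow> tag DL \<theta> \<lessdot> Sync [] uL l uR k"
  "\<theta> \<lessdot> Single uR (Vis (co l)) k \<Longrightarrow> tag DR \<theta> \<lessdot> Sync [] uL l uR k"
  by (metis dep_sync_right dep_tag side_eq_tag)+

lemma dep_sync_tag:
  "Single uL (Vis l) k \<lessdot> \<theta> \<Longrightarrow> Sync [] uL l uR k \<lessdot> tag DL \<theta>"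
  "Single uR (Vis (co l)) k \<lessdot> \<theta> \<Longrightarrow> Sync [] uL l uR k \<lessdot> tag DR \<theta>"
  by (metis dep_sync_left dep_tag side_eq_tag)+

text \<open>A dependency on one side is enough, so independent synchronisations are independent on
  both sides and both components can be exchanged.\<close>

lemma dep_sync_sync:
  "Single uL (Vis l) k \<lessdot> Single uL' (Vis l') k' \<Longrightarrow> Sync [] uL l uR k \<lessdot> Sync [] uL' l' uR' k'"
  "Single uR (Vis (co l)) k \<lessdot> Single uR' (Vis (co l')) k' \<Longrightarrow>
    Sync [] uL l uR k \<lessdot> Sync [] uL' l' uR' k'"
  by (metis dep_sync_both dep_tag side_eq_tag)+

lemma fwd_exchange:
  assumes "X \<midarrow>\<theta>\<^sub>1\<rightarrow> X\<^sub>1" "X\<^sub>1 \<midarrow>\<theta>\<^sub>2\<rightarrow> Y" "\<not> \<theta>\<^sub>1 \<lessdot> \<theta>\<^sub>2"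
  shows "\<exists>X\<^sub>2. X \<midarrow>\<theta>\<^sub>2\<rightarrow> X\<^sub>2 \<and> X\<^sub>2 \<midarrow>\<theta>\<^sub>1\<rightarrow> Y"
  using assms
\<comment> \<open>The second label varies because in the parallel cases the induction hypothesis is
  applied to an untagged label or to a component of a synchronisation.\<close>
proof (induction arbitrary: \<theta>\<^sub>2 Y rule: fwd.induct)
  case (act X \<alpha> k)
  then show ?case by (simp add: dep_prefix)
next
  case (pre X \<theta> X' k \<alpha>)
  \<comment> \<open>A keyed prefix moves only by \<open>pre\<close>, so the second label avoids
    \<open>k\<close> as well, and both labels reach the body unchanged.\<close>
  then show ?case by (metis KPrefix_fwdE fwd.pre)
next
  case (res X \<theta> X' a)
  from res.prems(1) obtain X'' where "Y = Restrict X'' a" "X' \<midarrow>\<theta>\<^sub>2\<rightarrow> X''"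
      "lab \<theta>\<^sub>2 \<notin> {Vis (Name a), Vis (Coname a)}"
    by (auto elim: Restrict_fwdE)
  moreover from this obtain X2 where "X \<midarrow>\<theta>\<^sub>2\<rightarrow> X2" "X2 \<midarrow>\<theta>\<rightarrow> X''"
    using res.IH res.prems(2) by blast
  ultimately have "Restrict X a \<midarrow>\<theta>\<^sub>2\<rightarrow> Restrict X2 a" "Restrict X2 a \<midarrow>\<theta>\<rightarrow> Y"
    using res.hyps(2) by (simp_all add: fwd.res)
  then show ?case by blast
next
  case (sumL X \<theta> X' Z)
  from sumL.prems(1) obtain X'' where "Y = Choice X'' Z" "X' \<midarrow>\<theta>\<^sub>2\<rightarrow> X''"
    using fwd_not_std[OF sumL.hyps(1)] by (auto elim: Choice_fwdE)
  moreover from this obtain X2 where "X \<midarrow>\<theta>\<^sub>2\<rightarrow> X2" "X2 \<midarrow>\<theta>\<rightarrow> X''"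
    using sumL.IH sumL.prems(2) by blast
  ultimately have "Choice X Z \<midarrow>\<theta>\<^sub>2\<rightarrow> Choice X2 Z" "Choice X2 Z \<midarrow>\<theta>\<rightarrow> Y"
    using sumL.hyps(2) by (simp_all add: fwd.sumL)
  then show ?case by blast
next
  case (sumR Z \<theta> Z' X)
  from sumR.prems(1) obtain Z'' where "Y = Choice X Z''" "Z' \<midarrow>\<theta>\<^sub>2\<rightarrow> Z''"
    using fwd_not_std[OF sumR.hyps(1)] by (auto elim: Choice_fwdE)
  moreover from this obtain Z2 where "Z \<midarrow>\<theta>\<^sub>2\<rightarrow> Z2" "Z2 \<midarrow>\<theta>\<rightarrow> Z''"
    using sumR.IH sumR.prems(2) by blast
  ultimately have "Choice X Z \<midarrow>\<theta>\<^sub>2\<rightarrow> Choice X Z2" "Choice X Z2 \<midarrow>\<theta>\<rightarrow> Y"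
    using sumR.hyps(2) by (simp_all add: fwd.sumR)
  then show ?case by blast
next
  case (parL X \<theta> X' Z)
  have X': "keys X' = insert (key_of \<theta>) (keys X)" using parL.hyps(1) by (rule fwd_keys)
  from parL.prems(1) show ?case
  proof (cases rule: Par_fwdE)
    case (left \<theta>' X'')
    then obtain X2 where "X \<midarrow>\<theta>'\<rightarrow> X2" "X2 \<midarrow>\<theta>\<rightarrow> X''"
      using parL.IH parL.prems(2) dep_tag by blast
    then have "Par X Z \<midarrow>tag DL \<theta>'\<rightarrow> Par X2 Z" "Par X2 Z \<midarrow>tag DL \<theta>\<rightarrow> Par X'' Z"
      using left parL.hyps by (simp_all add: fwd.parL)
    then show ?thesis using left by blast
  next
    \<comment> \<open>The steps lie in opposite components. As \<open>key_of \<theta>'\<close>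
      avoids \<open>keys X'\<close>, which contains \<open>key_of \<theta>\<close>, the two keys
      differ and both side conditions hold in the new order.\<close>
    case (right \<theta>' Z')
    then have "Par X Z \<midarrow>tag DR \<theta>'\<rightarrow> Par X Z'" "Par X Z' \<midarrow>tag DL \<theta>\<rightarrow> Par X' Z'"
      using parL.hyps X' fwd_keys[of Z \<theta>' Z'] by (auto intro!: fwd.parL fwd.parR)
    then show ?thesis using right by blast
  next
    case (sync uL l k X'' uR Z')
    have "\<not> \<theta> \<lessdot> Single uL (Vis l) k"
      using parL.prems(2) sync(1) by (auto dest: dep_tag_sync(1))
    with sync(3) obtain X2 where X2: "X \<midarrow>Single uL (Vis l) k\<rightarrow> X2" "X2 \<midarrow>\<theta>\<rightarrow> X''"
      using parL.IH by blast
    \<comment> \<open>The synchronisation now comes first and adds \<open>k\<close> on the right, so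
      \<open>parL\<close> requires \<open>key_of \<theta>\<close> to differ from \<open>k\<close>;
      the exchanged steps on the left show this.\<close>
    have "key_of \<theta> \<notin> keys Z'"
      using fwd_keys[OF sync(4)] fwd_fwd_key_neq[OF X2] parL.hyps by simp
    then have "Par X Z \<midarrow>Sync [] uL l uR k\<rightarrow> Par X2 Z'" "Par X2 Z' \<midarrow>tag DL \<theta>\<rightarrow> Par X'' Z'"
      using sync X2 by (simp_all add: fwd.syn fwd.parL)
    then show ?thesis using sync by blast
  qed
next
  case (parR Z \<theta> Z' X)
  have Z': "keys Z' = insert (key_of \<theta>) (keys Z)" using parR.hyps(1) by (rule fwd_keys)
  from parR.prems(1) show ?case
  proof (cases rule: Par_fwdE)
    case (left \<theta>' X')
    then have "Par X Z \<midarrow>tag DL \<theta>'\<rightarrow> Par X' Z" "Par X' Z \<midarrow>tag DR \<theta>\<rightarrow> Par X' Z'"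
      using parR.hyps Z' fwd_keys[of X \<theta>' X'] by (auto intro!: fwd.parL fwd.parR)
    then show ?thesis using left by blast
  next
    case (right \<theta>' Z'')
    then obtain Z2 where "Z \<midarrow>\<theta>'\<rightarrow> Z2" "Z2 \<midarrow>\<theta>\<rightarrow> Z''"
      using parR.IH parR.prems(2) dep_tag by blast
    then have "Par X Z \<midarrow>tag DR \<theta>'\<rightarrow> Par X Z2" "Par X Z2 \<midarrow>tag DR \<theta>\<rightarrow> Par X Z''"
      using right parR.hyps by (simp_all add: fwd.parR)
    then show ?thesis using right by blast
  next
    case (sync uL l k X' uR Z'')
    have "\<not> \<theta> \<lessdot> Single uR (Vis (co l)) k"
      using parR.prems(2) sync(1) by (auto dest: dep_tag_sync(2))
    with sync(4) obtain Z2 where Z2: "Z \<midarrow>Single uR (Vis (co l)) k\<rightarrow> Z2" "Z2 \<midarrow>\<theta>\<rightarrow> Z''"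
      using parR.IH by blast
    have "key_of \<theta> \<notin> keys X'"
      using fwd_keys[OF sync(3)] fwd_fwd_key_neq[OF Z2] parR.hyps by simp
    then have "Par X Z \<midarrow>Sync [] uL l uR k\<rightarrow> Par X' Z2" "Par X' Z2 \<midarrow>tag DR \<theta>\<rightarrow> Par X' Z''"
      using sync Z2 by (simp_all add: fwd.syn fwd.parR)
    then show ?thesis using sync by blast
  qed
next
  case (syn X uL l k X' Z uR Z')
  have X': "keys X' = insert k (keys X)" and Z': "keys Z' = insert k (keys Z)"
    using syn.hyps fwd_keys by fastforce+
  from syn.prems(1) show ?case
  proof (cases rule: Par_fwdE)
    case (left \<theta>' X'')
    have "\<not> Single uL (Vis l) k \<lessdot> \<theta>'"
      using syn.prems(2) left(1) by (auto dest: dep_sync_tag(1))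
    with left(3) obtain X2 where "X \<midarrow>\<theta>'\<rightarrow> X2" "X2 \<midarrow>Single uL (Vis l) k\<rightarrow> X''"
      using syn.IH(1) by blast
    \<comment> \<open>The key of \<open>\<theta>'\<close> avoids \<open>keys Z'\<close> and hence
      the smaller set \<open>keys Z\<close>, so \<open>parL\<close> already applies before the
      synchronisation.\<close>
    then have "Par X Z \<midarrow>tag DL \<theta>'\<rightarrow> Par X2 Z" "Par X2 Z \<midarrow>Sync [] uL l uR k\<rightarrow> Par X'' Z'"
      using left syn.hyps Z' by (simp_all add: fwd.syn fwd.parL)
    then show ?thesis using left by blast
  next
    case (right \<theta>' Z'')
    have "\<not> Single uR (Vis (co l)) k \<lessdot> \<theta>'"
      using syn.prems(2) right(1) by (auto dest: dep_sync_tag(2))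
    with right(3) obtain Z2 where "Z \<midarrow>\<theta>'\<rightarrow> Z2" "Z2 \<midarrow>Single uR (Vis (co l)) k\<rightarrow> Z''"
      using syn.IH(2) by blast
    then have "Par X Z \<midarrow>tag DR \<theta>'\<rightarrow> Par X Z2" "Par X Z2 \<midarrow>Sync [] uL l uR k\<rightarrow> Par X' Z''"
      using right syn.hyps X' by (simp_all add: fwd.syn fwd.parR)
    then show ?thesis using right by blast
  next
    case (sync uL' l' k' X'' uR' Z'')
    have "\<not> Single uL (Vis l) k \<lessdot> Single uL' (Vis l') k'"
      "\<not> Single uR (Vis (co l)) k \<lessdot> Single uR' (Vis (co l')) k'"
      using syn.prems(2) sync(1) by (auto dest: dep_sync_sync)
    \<comment> \<open>Each component is exchanged separately. The component labels are preserved, so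
      the intermediate processes \<open>X2\<close> and \<open>Z2\<close> are reached by one
      synchronisation and left by the other.\<close>
    with syn.IH sync(3,4) obtain X2 Z2 where
      "X \<midarrow>Single uL' (Vis l') k'\<rightarrow> X2" "X2 \<midarrow>Single uL (Vis l) k\<rightarrow> X''"
      "Z \<midarrow>Single uR' (Vis (co l')) k'\<rightarrow> Z2" "Z2 \<midarrow>Single uR (Vis (co l)) k\<rightarrow> Z''"
      by meson
    then have "Par X Z \<midarrow>Sync [] uL' l' uR' k'\<rightarrow> Par X2 Z2"
      "Par X2 Z2 \<midarrow>Sync [] uL l uR k\<rightarrow> Par X'' Z''"
      by (simp_all add: fwd.syn)
    then show ?thesis using sync by blast
  qed
qed

theorem theorem1:
  fixes X X\<^sub>1 Y :: "('n, 'k) process" and \<theta>\<^sub>1 \<theta>\<^sub>2 :: "('n, 'k) elabel"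
  assumes "reachable X" and "reachable X\<^sub>1" and "reachable Y"
    and "X \<midarrow>\<theta>\<^sub>1\<rightarrow> X\<^sub>1" and "X\<^sub>1 \<midarrow>\<theta>\<^sub>2\<rightarrow> Y"
    and "concurrent_in [\<theta>\<^sub>1, \<theta>\<^sub>2] 0 1"
  shows "\<exists>X\<^sub>2. X \<midarrow>\<theta>\<^sub>2\<rightarrow> X\<^sub>2 \<and> X\<^sub>2 \<midarrow>\<theta>\<^sub>1\<rightarrow> Y"
proof -
  \<comment> \<open>Since \<open>dep_in\<close> respects the order of positions, concurrency in a
    trace of two labels amounts to the absence of a dependency of the second on the first.\<close>
  have "\<not> \<theta>\<^sub>1 \<lessdot> \<theta>\<^sub>2"
    using assms(6) by (simp add: concurrent_in_def dep_in_def)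
  with assms(4,5) show ?thesis by (rule fwd_exchange)
qed

end
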